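(* Let $(P,\mu,\eta,c)$ be an H-group and let $N$ be a normal sub-H-group of $P$. Then the group $P/N$, endowed with the quotient topology induced from $P$ by the canonical map $\pi:P\to P/N$, $\pi(g)=gN$, is a quasitopological group.
   Context: An H-group $(P,\mu,\eta,c)$ is a pointed space $(P,p_0)$ with continuous pointed maps $\mu:P\times P\to P$, $\eta:P\to P$ and the constant map $c:P\to P$ at $p_0$ such that, via pointed homotopies, $\mu(1_P,c)\simeq\mu(c,1_P)\simeq 1_P$, $\mu(\eta,1_P)\simeq\mu(1_P,\eta)\simeq c$ and $\mu(\mu\times 1_P)\simeq\mu(1_P\times\mu)$. Write $g.h=\mu(g,h)$ and $g^{-1}=\eta(g)$. An H-homomorphism between H-groups $(P,\mu,\eta,c)$ and $(Q,\mu_2,\eta_2,c_2)$ is a continuous map $\varphi:P\to Q$ with $\varphi\mu\simeq\mu_2(\varphi\times\varphi)$ and $\varphi\eta\simeq\eta_2\varphi$. A sub-H-group of $P$ is a pointed subspace $P'\ni p_0$ which is itself an H-group (with base point $p_0$) such that the inclusion $P'\to P$ is an H-homomorphism. For $A\subseteq P$ and $g\in P$, write $g\,\widetilde{\in}\,A$ if there is a path in $P$ from $g$ to a point of $A$. The left coset of a sub-H-group $P'$ is $gP'=\{g'\in P\mid g^{-1}.g'\,\widetilde{\in}\,P'\}$. A sub-H-group $P'$ is normal if $g.g'.g^{-1}\,\widetilde{\in}\,P'$ for all $g\in P$, $g'\in P'$; then $P/P'=\{gP'\mid g\in P\}$ is a group under $(g_1P').(g_2P')=(g_1.g_2)P'$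 and $(gP')^{-1}=g^{-1}P'$. A quasitopological group is a group with a topology such that inversion and all (left and right) translations are continuous. *)

theory Defs
  imports "HOL-Analysis.Analysis" "HOL-Algebra.Group"
begin

text \<open>
  A pointed space is a topology \<open>X\<close> with a point \<open>p0\<close> of \<open>topspace X\<close>.  The constant map \<open>c\<close> of an
  H-group is determined by \<open>p0\<close> and is written \<open>\<lambda>_. p0\<close>.  The property argument of
  \<^const>\<open>homotopic_with\<close> is imposed at every time of the homotopy, so it expresses that the homotopy is
  pointed.  The two sides of associativity are compared on \<open>P \<times> (P \<times> P)\<close>, identified with
  \<open>(P \<times> P) \<times> P\<close> in the usual way.
\<close>

definition H_group :: "'a topology \<Rightarrow> 'a \<Rightarrow> ('a \<times> 'a \<Rightarrow> 'a) \<Rightarrow> ('a \<Rightarrow> 'a) \<Rightarrow> bool" where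
  "H_group X p0 \<mu> \<eta> \<longleftrightarrow>
     p0 \<in> topspace X \<and>
     continuous_map (prod_topology X X) X \<mu> \<and> \<mu> (p0, p0) = p0 \<and>
     continuous_map X X \<eta> \<and> \<eta> p0 = p0 \<and>
     homotopic_with (\<lambda>h. h p0 = p0) X X (\<lambda>x. \<mu> (x, p0)) (\<lambda>x. x) \<and>
     homotopic_with (\<lambda>h. h p0 = p0) X X (\<lambda>x. \<mu> (p0, x)) (\<lambda>x. x) \<and>
     homotopic_with (\<lambda>h. h p0 = p0) X X (\<lambda>x. \<mu> (\<eta> x, x)) (\<lambda>_. p0) \<and>
     homotopic_with (\<lambda>h. h p0 = p0) X X (\<lambda>x. \<mu> (x, \<eta> x)) (\<lambda>_. p0) \<and>
     homotopic_with (\<lambda>h. h (p0, p0, p0) = p0) (prod_topology X (prod_topology X X)) X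
       (\<lambda>(x, y, z). \<mu> (\<mu> (x, y), z)) (\<lambda>(x, y, z). \<mu> (x, \<mu> (y, z)))"

text \<open>The homotopies of an H-homomorphism are free (not required to be pointed).\<close>

definition H_homomorphism ::
  "'a topology \<Rightarrow> ('a \<times> 'a \<Rightarrow> 'a) \<Rightarrow> ('a \<Rightarrow> 'a) \<Rightarrow>
   'b topology \<Rightarrow> ('b \<times> 'b \<Rightarrow> 'b) \<Rightarrow> ('b \<Rightarrow> 'b) \<Rightarrow> ('a \<Rightarrow> 'b) \<Rightarrow> bool" where
  "H_homomorphism X \<mu> \<eta> Y \<mu>2 \<eta>2 \<phi> \<longleftrightarrow>
     continuous_map X Y \<phi> \<and>
     homotopic_with (\<lambda>_. True) (prod_topology X X) Y
       (\<lambda>(x, y). \<phi> (\<mu> (x, y))) (\<lambda>(x, y). \<mu>2 (\<phi> x, \<phi> y)) \<and>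
     homotopic_with (\<lambda>_. True) X Y (\<lambda>x. \<phi> (\<eta> x)) (\<lambda>x. \<eta>2 (\<phi> x))"

text \<open>
  The operations of a sub-H-group need not be restrictions of those of \<open>X\<close>.
\<close>

definition sub_H_group ::
  "'a topology \<Rightarrow> 'a \<Rightarrow> ('a \<times> 'a \<Rightarrow> 'a) \<Rightarrow> ('a \<Rightarrow> 'a) \<Rightarrow> 'a set \<Rightarrow> bool" where
  "sub_H_group X p0 \<mu> \<eta> N \<longleftrightarrow>
     N \<subseteq> topspace X \<and>
     (\<exists>\<mu>' \<eta>'. H_group (subtopology X N) p0 \<mu>' \<eta>' \<and>
        H_homomorphism (subtopology X N) \<mu>' \<eta>' X \<mu> \<eta> (\<lambda>x. x))"

definition path_into :: "'a topology \<Rightarrow> 'a \<Rightarrow> 'a set \<Rightarrow> bool" where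
  "path_into X g A \<longleftrightarrow> (\<exists>a\<in>A. path_component_of X g a)"

definition left_coset ::
  "'a topology \<Rightarrow> ('a \<times> 'a \<Rightarrow> 'a) \<Rightarrow> ('a \<Rightarrow> 'a) \<Rightarrow> 'a set \<Rightarrow> 'a \<Rightarrow> 'a set" where
  "left_coset X \<mu> \<eta> N g = {g' \<in> topspace X. path_into X (\<mu> (\<eta> g, g')) N}"

definition normal_sub_H_group ::
  "'a topology \<Rightarrow> 'a \<Rightarrow> ('a \<times> 'a \<Rightarrow> 'a) \<Rightarrow> ('a \<Rightarrow> 'a) \<Rightarrow> 'a set \<Rightarrow> bool" where
  "normal_sub_H_group X p0 \<mu> \<eta> N \<longleftrightarrow>
     sub_H_group X p0 \<mu> \<eta> N \<and>
     (\<forall>g\<in>topspace X. \<forall>g'\<in>N. path_into X (\<mu> (\<mu> (g, g'), \<eta> g)) N)"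

text \<open>
  \<open>P/N\<close> with the multiplication \<open>(gN).(hN) = (g.h)N\<close>.  The description operator picks the common
  value of \<open>(g.h)N\<close> over all representatives \<open>g\<close> and \<open>h\<close>; for normal \<open>N\<close> it is unique.
\<close>

definition coset_group ::
  "'a topology \<Rightarrow> 'a \<Rightarrow> ('a \<times> 'a \<Rightarrow> 'a) \<Rightarrow> ('a \<Rightarrow> 'a) \<Rightarrow> 'a set \<Rightarrow> 'a set monoid" where
  "coset_group X p0 \<mu> \<eta> N =
     \<lparr>carrier = left_coset X \<mu> \<eta> N ` topspace X,
      mult = (\<lambda>A B. THE C. \<exists>g\<in>topspace X. \<exists>h\<in>topspace X.
                A = left_coset X \<mu> \<eta> N g \<and> B = left_coset X \<mu> \<eta> N h \<and>
                C = left_coset X \<mu> \<eta> N (\<mu> (g, h))),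
      one = left_coset X \<mu> \<eta> N p0\<rparr>"

definition quotient_topology :: "'a topology \<Rightarrow> ('a \<Rightarrow> 'b) \<Rightarrow> 'b topology" where
  "quotient_topology X f =
     topology (\<lambda>U. U \<subseteq> f ` topspace X \<and> openin X {x \<in> topspace X. f x \<in> U})"

lemma openin_quotient_topology:
  "openin (quotient_topology X f) U \<longleftrightarrow>
     U \<subseteq> f ` topspace X \<and> openin X {x \<in> topspace X. f x \<in> U}"
proof -
  have "istopology (\<lambda>U. U \<subseteq> f ` topspace X \<and> openin X {x \<in> topspace X. f x \<in> U})"
    unfolding istopology_def
  proof (rule conjI; intro allI impI)
    fix S T
    assume S: "S \<subseteq> f ` topspace X \<and> openin X {x \<in> topspace X. f x \<in> S}"
      and T: "T \<subseteq> f ` topspace X \<and> openin X {x \<in> topspace X. f x \<in> T}"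
    have "{x \<in> topspace X. f x \<in> S \<inter> T} =
        {x \<in> topspace X. f x \<in> S} \<inter> {x \<in> topspace X. f x \<in> T}"
      by auto
    then show "S \<inter> T \<subseteq> f ` topspace X \<and> openin X {x \<in> topspace X. f x \<in> S \<inter> T}"
      using S T by auto
  next
    fix \<K>
    assume K: "\<forall>K\<in>\<K>. K \<subseteq> f ` topspace X \<and> openin X {x \<in> topspace X. f x \<in> K}"
    have "{x \<in> topspace X. f x \<in> \<Union>\<K>} = (\<Union>K\<in>\<K>. {x \<in> topspace X. f x \<in> K})"
      by auto
    then show "\<Union>\<K> \<subseteq> f ` topspace X \<and> openin X {x \<in> topspace X. f x \<in> \<Union>\<K>}"
      using K by auto
  qed
  then show ?thesis
    by (simp add: quotient_topology_def topology_inverse')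
qed

lemma topspace_quotient_topology: "topspace (quotient_topology X f) = f ` topspace X"
proof -
  have "{x \<in> topspace X. f x \<in> f ` topspace X} = topspace X"
    by auto
  then have "openin (quotient_topology X f) (f ` topspace X)"
    by (simp add: openin_quotient_topology)
  then show ?thesis
    by (meson openin_quotient_topology openin_subset openin_topspace subset_antisym)
qed

lemma quotient_map_quotient_topology: "quotient_map X (quotient_topology X f) f"
  by (simp add: quotient_map_def openin_quotient_topology topspace_quotient_topology)

definition quasitopological_group :: "('a, 'b) monoid_scheme \<Rightarrow> 'a topology \<Rightarrow> bool" where
  "quasitopological_group G T \<longleftrightarrow>
     group G \<and> topspace T = carrier G \<and>
     continuous_map T T (\<lambda>x. inv\<^bsub>G\<^esub> x) \<and>
     (\<forall>a\<in>carrier G. continuous_map T T (\<lambda>x. a \<otimes>\<^bsub>G\<^esub> x)) \<and>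
     (\<forall>a\<in>carrier G. continuous_map T T (\<lambda>x. x \<otimes>\<^bsub>G\<^esub> a))"

end

theory Submission
  imports Defs "HOL-Algebra.Coset"
begin

text \<open>
  The homotopies of an H-group turn the set of path components of \<open>P\<close> into a group, and the path
  components meeting \<open>N\<close> form a normal subgroup \<open>H\<close> of it.  The left cosets of \<open>N\<close> are exactly the
  preimages of the cosets of \<open>H\<close>, so \<open>P/N\<close> is the factor group by \<open>H\<close>.  Inversion and translations of
  \<open>P/N\<close> lift along the quotient map to \<open>\<eta>\<close> and to the translations of \<open>P\<close>, which are continuous.
\<close>

section \<open>Homotopies and path components\<close>

lemma homotopic_with_imp_path_component_of:
  assumes "homotopic_with Q X Y f g" and x: "x \<in> topspace X"
  shows "path_component_of Y (f x) (g x)"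
proof -
  obtain h where h: "continuous_map (prod_topology (top_of_set {0..1::real}) X) Y h"
      "h (0, x) = f x" "h (1, x) = g x"
    using assms(1) unfolding homotopic_with_def by blast
  \<comment> \<open>The homotopy restricted to the slice over \<open>x\<close> is the track of
    \<open>x\<close>, a path from \<open>f x\<close> to \<open>g x\<close>.\<close>
  have "continuous_map (top_of_set {0..1::real}) (prod_topology (top_of_set {0..1}) X) (\<lambda>t. (t, x))"
    using x by (simp add: continuous_map_pairwise o_def)
  then have "continuous_map (top_of_set {0..1::real}) Y (h \<circ> (\<lambda>t. (t, x)))"
    using h(1) continuous_map_compose by blast
  then show ?thesis
    unfolding path_component_of_def pathin_def using h(2,3) by force
qed

text \<open>The hypothesis rules out two points outside the space, whose component sets are both
  empty, hence equal, although no path joins them.\<close>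

lemma path_component_of_set_eq_iff:
  assumes "x \<in> topspace X"
  shows "path_component_of_set X x = path_component_of_set X y \<longleftrightarrow> path_component_of X x y"
  using assms by (metis mem_Collect_eq path_component_in_topspace path_component_of_equiv)

text \<open>The union over all representatives avoids a choice of points; it is a single component
  once \<mu> respects path components.\<close>

definition path_component_group ::
  "'a topology \<Rightarrow> 'a \<Rightarrow> ('a \<times> 'a \<Rightarrow> 'a) \<Rightarrow> 'a set monoid" where
  "path_component_group X p0 \<mu> =
     \<lparr>carrier = path_components_of X,
      mult = (\<lambda>A B. \<Union>a\<in>A. \<Union>b\<in>B. path_component_of_set X (\<mu> (a, b))),
      one = path_component_of_set X p0\<rparr>"

section \<open>The group of path components of an H-group\<close>

locale H_group_space =
  fixes X :: "'a topology" and p0 :: 'a and \<mu> :: "'a \<times> 'a \<Rightarrow> 'a" and \<eta> :: "'a \<Rightarrow> 'a"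
  assumes H_group: "H_group X p0 \<mu> \<eta>"
begin

abbreviation \<G> where "\<G> \<equiv> path_component_group X p0 \<mu>"
abbreviation pc where "pc \<equiv> path_component_of_set X"

lemma base_in: "p0 \<in> topspace X"
  and continuous_mult: "continuous_map (prod_topology X X) X \<mu>"
  and continuous_inv: "continuous_map X X \<eta>"
  and homotopic_l_one: "homotopic_with (\<lambda>h. h p0 = p0) X X (\<lambda>x. \<mu> (p0, x)) (\<lambda>x. x)"
  and homotopic_l_inv: "homotopic_with (\<lambda>h. h p0 = p0) X X (\<lambda>x. \<mu> (\<eta> x, x)) (\<lambda>_. p0)"
  and homotopic_assoc: "homotopic_with (\<lambda>h. h (p0, p0, p0) = p0)
    (prod_topology X (prod_topology X X)) X
    (\<lambda>(x, y, z). \<mu> (\<mu> (x, y), z)) (\<lambda>(x, y, z). \<mu> (x, \<mu> (y, z)))"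
  using H_group unfolding H_group_def by blast+

lemma mult_in: "x \<in> topspace X \<Longrightarrow> y \<in> topspace X \<Longrightarrow> \<mu> (x, y) \<in> topspace X"
  using continuous_mult unfolding continuous_map_def by auto

lemma inv_in: "x \<in> topspace X \<Longrightarrow> \<eta> x \<in> topspace X"
  using continuous_inv unfolding continuous_map_def by auto

text \<open>Two paths form a path in the product, which the continuous map \<mu> carries to a path
  in \<open>X\<close>.\<close>

lemma path_component_of_mult:
  assumes "path_component_of X x x'" "path_component_of X y y'"
  shows "path_component_of X (\<mu> (x, y)) (\<mu> (x', y'))"
proof -
  have "(x', y') \<in> path_component_of_set (prod_topology X X) (x, y)"
    using assms by simp
  then show ?thesis
    using path_component_of_continuous_image[OF continuous_mult, of "(x, y)" "(x', y')"] by blast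
qed

lemma carrier_eq: "carrier \<G> = pc ` topspace X"
  by (simp add: path_component_group_def path_components_of_def)

lemma one_eq: "\<one>\<^bsub>\<G>\<^esub> = pc p0"
  by (simp add: path_component_group_def)

lemma pc_mult:
  assumes "x \<in> topspace X" "y \<in> topspace X"
  shows "pc x \<otimes>\<^bsub>\<G>\<^esub> pc y = pc (\<mu> (x, y))"
proof -
  have "pc (\<mu> (a, b)) = pc (\<mu> (x, y))" if "a \<in> pc x" "b \<in> pc y" for a b
    using path_component_of_mult[of x a y b] that assms
    by (simp add: path_component_of_set_eq_iff[OF mult_in, symmetric])
  then have "(\<Union>a\<in>pc x. \<Union>b\<in>pc y. pc (\<mu> (a, b))) = (\<Union>a\<in>pc x. \<Union>b\<in>pc y. pc (\<mu> (x, y)))"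
    by (intro SUP_cong refl)
  also have "\<dots> = pc (\<mu> (x, y))"
  proof -
    \<comment> \<open>A union of a constant family is that constant only over nonempty index
      sets.\<close>
    have "pc x \<noteq> {}" "pc y \<noteq> {}"
      using assms by (simp_all only: path_component_of_eq_empty not_not)
    then show ?thesis
      by (simp only: UN_constant if_False)
  qed
  finally show ?thesis
    by (simp add: path_component_group_def)
qed

text \<open>Leaving \<open>Q\<close> and \<open>Z\<close> arbitrary covers both the pointed
  homotopies of the H-group laws and the free homotopies of the inclusion of
  \<open>N\<close>.\<close>

lemma pc_eqI:
  "homotopic_with Q Z X f g \<Longrightarrow> z \<in> topspace Z \<Longrightarrow> pc (f z) = pc (g z)"
  using homotopic_with_imp_path_component_of by (metis path_component_of_equiv)

lemma pc_l_inv: "x \<in> topspace X \<Longrightarrow> pc (\<eta> x) \<otimes>\<^bsub>\<G>\<^esub> pc x = \<one>\<^bsub>\<G>\<^esub>"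
  using pc_eqI[OF homotopic_l_inv] by (simp add: pc_mult inv_in one_eq)

lemma group_path_component_group: "group \<G>"
proof (rule groupI)
  fix A B C
  assume "A \<in> carrier \<G>" "B \<in> carrier \<G>" "C \<in> carrier \<G>"
  then obtain x y z where xyz: "x \<in> topspace X" "y \<in> topspace X" "z \<in> topspace X"
      "A = pc x" "B = pc y" "C = pc z"
    by (auto simp: carrier_eq)
  have "pc (\<mu> (\<mu> (x, y), z)) = pc (\<mu> (x, \<mu> (y, z)))"
    using xyz(1-3) pc_eqI[OF homotopic_assoc, of "(x, y, z)"] by simp
  then show "A \<otimes>\<^bsub>\<G>\<^esub> B \<otimes>\<^bsub>\<G>\<^esub> C = A \<otimes>\<^bsub>\<G>\<^esub> (B \<otimes>\<^bsub>\<G>\<^esub> C)"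
    using xyz by (simp add: pc_mult mult_in)
next
  fix A assume "A \<in> carrier \<G>"
  then obtain x where x: "x \<in> topspace X" "A = pc x"
    by (auto simp: carrier_eq)
  then show "\<one>\<^bsub>\<G>\<^esub> \<otimes>\<^bsub>\<G>\<^esub> A = A"
    using pc_eqI[OF homotopic_l_one] by (simp add: pc_mult one_eq base_in)
  show "\<exists>B\<in>carrier \<G>. B \<otimes>\<^bsub>\<G>\<^esub> A = \<one>\<^bsub>\<G>\<^esub>"
    using x pc_l_inv inv_in by (auto simp: carrier_eq)
qed (auto simp: carrier_eq pc_mult mult_in one_eq base_in)

lemma pc_inv: "x \<in> topspace X \<Longrightarrow> inv\<^bsub>\<G>\<^esub> (pc x) = pc (\<eta> x)"
  by (rule group.inv_equality[OF group_path_component_group])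
    (auto simp: pc_l_inv carrier_eq inv_in)

section \<open>The normal subgroup of components meeting \<open>N\<close>\<close>

lemma path_into_iff_pc:
  assumes "x \<in> topspace X"
  shows "path_into X x A \<longleftrightarrow> pc x \<in> pc ` A"
  using assms by (auto simp: path_into_def path_component_of_set_eq_iff)

text \<open>The operations of \<open>N\<close> may differ from those of \<open>X\<close>, but the
  inclusion is an H-homomorphism, so on points of \<open>N\<close> both give results in the same
  path component of \<open>X\<close>. Closure of \<open>N\<close> under its own operations then
  yields closure in \<open>\<G>\<close>.\<close>

lemma subgroup_pc_image:
  assumes "sub_H_group X p0 \<mu> \<eta> N"
  shows "subgroup (pc ` N) \<G>"
proof -
  let ?S = "subtopology X N"
  obtain \<mu>' \<eta>' where N: "N \<subseteq> topspace X" and G': "H_group ?S p0 \<mu>' \<eta>'"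
    and hom: "homotopic_with (\<lambda>_. True) (prod_topology ?S ?S) X
       (\<lambda>(x, y). \<mu>' (x, y)) (\<lambda>(x, y). \<mu> (x, y))" "homotopic_with (\<lambda>_. True) ?S X \<eta>' \<eta>"
    using assms unfolding sub_H_group_def H_homomorphism_def by auto
  \<comment> \<open>This instance places \<open>p0\<close> in \<open>N\<close> and keeps
    \<open>N\<close> closed under \<open>\<mu>'\<close> and \<open>\<eta>'\<close>; the abbreviation
    \<open>pc\<close> still refers to components of \<open>X\<close>.\<close>
  interpret S: H_group_space ?S p0 \<mu>' \<eta>'
    by unfold_locales (rule G')
  have top: "topspace ?S = N"
    using N by auto
  show ?thesis
  proof (rule group.subgroupI[OF group_path_component_group])
    show "pc ` N \<subseteq> carrier \<G>"
      using N by (auto simp: carrier_eq)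
    show "pc ` N \<noteq> {}"
      using S.base_in top by auto
    fix A assume "A \<in> pc ` N"
    then obtain x where x: "x \<in> N" "A = pc x" by auto
    then have "pc (\<eta>' x) = pc (\<eta> x)" "\<eta>' x \<in> N"
      using pc_eqI[OF hom(2)] S.inv_in top by blast+
    then have "inv\<^bsub>\<G>\<^esub> A = pc (\<eta>' x)"
      using x(2) pc_inv[OF subsetD[OF N x(1)]] by simp
    then show "inv\<^bsub>\<G>\<^esub> A \<in> pc ` N"
      using \<open>\<eta>' x \<in> N\<close> by simp
    fix B assume "B \<in> pc ` N"
    then obtain y where y: "y \<in> N" "B = pc y" by auto
    have "pc (\<mu>' (x, y)) = pc (\<mu> (x, y))" "\<mu>' (x, y) \<in> N"
      using pc_eqI[OF hom(1), of "(x, y)"] S.mult_in[of x y] x y top by auto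
    then have "A \<otimes>\<^bsub>\<G>\<^esub> B = pc (\<mu>' (x, y))"
      using x(2) y(2) pc_mult[OF subsetD[OF N x(1)] subsetD[OF N y(1)]] by simp
    then show "A \<otimes>\<^bsub>\<G>\<^esub> B \<in> pc ` N"
      using \<open>\<mu>' (x, y) \<in> N\<close> by simp
  qed
qed

lemma normal_pc_image:
  assumes "normal_sub_H_group X p0 \<mu> \<eta> N"
  shows "pc ` N \<lhd> \<G>"
proof -
  have sub: "sub_H_group X p0 \<mu> \<eta> N" and N: "N \<subseteq> topspace X"
    using assms unfolding normal_sub_H_group_def sub_H_group_def by auto
  have "A \<otimes>\<^bsub>\<G>\<^esub> B \<otimes>\<^bsub>\<G>\<^esub> inv\<^bsub>\<G>\<^esub> A \<in> pc ` N" if AB: "A \<in> carrier \<G>" "B \<in> pc ` N" for A B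
  proof -
    obtain g n where gn: "g \<in> topspace X" "n \<in> N" "n \<in> topspace X" "A = pc g" "B = pc n"
      using AB N unfolding carrier_eq by blast
    then have "path_into X (\<mu> (\<mu> (g, n), \<eta> g)) N"
      using assms unfolding normal_sub_H_group_def by blast
    then show ?thesis
      using gn by (simp add: path_into_iff_pc pc_inv pc_mult mult_in inv_in)
  qed
  then show ?thesis
    using subgroup_pc_image[OF sub]
    by (simp add: group.normal_inv_iff[OF group_path_component_group])
qed

section \<open>Left cosets and the factor group\<close>

context
  fixes N :: "'a set"
  assumes normal: "normal_sub_H_group X p0 \<mu> \<eta> N"
begin

abbreviation L where "L \<equiv> left_coset X \<mu> \<eta> N"
abbreviation Q where "Q \<equiv> coset_group X p0 \<mu> \<eta> N"
text \<open>Right cosets are chosen because the factor group \<open>Mod\<close> consists of them; by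
  normality they agree with left cosets.\<close>

abbreviation coset where "coset g \<equiv> pc ` N #>\<^bsub>\<G>\<^esub> pc g"

text \<open>A path from \<open>\<mu> (\<eta> g, x)\<close> into \<open>N\<close> says that the
  inverse of \<open>pc g\<close> times \<open>pc x\<close> lies in the subgroup, that is,
  \<open>pc x\<close> lies in the left coset of \<open>pc g\<close>. Normality exchanges left for
  right.\<close>

lemma left_coset_eq_vimage:
  assumes g: "g \<in> topspace X"
  shows "L g = {x \<in> topspace X. pc x \<in> coset g}"
proof -
  interpret normal "pc ` N" \<G>
    by (rule normal_pc_image[OF normal])
  have "path_into X (\<mu> (\<eta> g, x)) N \<longleftrightarrow> pc x \<in> coset g" if x: "x \<in> topspace X" for x
  proof -
    have car: "pc g \<in> carrier \<G>" "pc x \<in> carrier \<G>"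
      using g x by (auto simp: carrier_eq)
    have "path_into X (\<mu> (\<eta> g, x)) N \<longleftrightarrow> inv\<^bsub>\<G>\<^esub> pc g \<otimes>\<^bsub>\<G>\<^esub> pc x \<in> pc ` N"
      using g x by (simp add: path_into_iff_pc pc_inv pc_mult mult_in inv_in)
    also have "\<dots> \<longleftrightarrow> pc x \<in> pc g <#\<^bsub>\<G>\<^esub> pc ` N"
      using lcos_module_rev[OF is_group car] car
      by (auto simp: l_coset_def m_assoc[symmetric])
    also have "\<dots> \<longleftrightarrow> pc x \<in> coset g"
      using coset_eq car by blast
    finally show ?thesis .
  qed
  then show ?thesis
    unfolding left_coset_def by blast
qed

text \<open>Passing to preimages loses nothing: every member of \<open>coset g\<close> is the
  component of some point, so the image of \<open>L g\<close> under \<open>pc\<close> recovers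
  \<open>coset g\<close>.\<close>

lemma left_coset_eq_iff:
  assumes "g \<in> topspace X" "h \<in> topspace X"
  shows "L g = L h \<longleftrightarrow> coset g = coset h"
proof -
  interpret normal "pc ` N" \<G>
    by (rule normal_pc_image[OF normal])
  have image: "coset x = pc ` L x" if "x \<in> topspace X" for x
  proof -
    have "coset x \<subseteq> pc ` topspace X"
      using r_coset_subset_G[OF subset, of "pc x"] that by (simp add: carrier_eq)
    then show ?thesis
      using that by (auto simp: left_coset_eq_vimage)
  qed
  show ?thesis
  proof
    assume "L g = L h"
    then show "coset g = coset h"
      by (simp only: image assms)
  next
    assume "coset g = coset h"
    then show "L g = L h"
      by (simp only: left_coset_eq_vimage assms)
  qed
qed

text \<open>The description operator has a unique candidate because
  \<open>coset (\<mu> (x, y))\<close> is the set product of \<open>coset x\<close> and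
  \<open>coset y\<close>, hence independent of representatives.\<close>

lemma left_coset_mult:
  assumes g: "g \<in> topspace X" and h: "h \<in> topspace X"
  shows "L g \<otimes>\<^bsub>Q\<^esub> L h = L (\<mu> (g, h))"
proof -
  interpret normal "pc ` N" \<G>
    by (rule normal_pc_image[OF normal])
  have sum: "coset (\<mu> (x, y)) = coset x <#>\<^bsub>\<G>\<^esub> coset y"
    if "x \<in> topspace X" "y \<in> topspace X" for x y
    using that by (simp add: rcos_sum carrier_eq pc_mult)
  have "L (\<mu> (g', h')) = L (\<mu> (g, h))"
    if "g' \<in> topspace X" "h' \<in> topspace X" "L g = L g'" "L h = L h'" for g' h'
    using that g h by (simp add: left_coset_eq_iff mult_in sum)
  then have "(THE C. \<exists>g'\<in>topspace X. \<exists>h'\<in>topspace X.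
      L g = L g' \<and> L h = L h' \<and> C = L (\<mu> (g', h'))) = L (\<mu> (g, h))"
    using g h by (intro the_equality) blast+
  then show ?thesis
    by (simp add: coset_group_def)
qed

lemma group_coset_group: "group Q"
proof -
  interpret normal "pc ` N" \<G>
    by (rule normal_pc_image[OF normal])
  \<comment> \<open>Elements of the factor group are sets of components; \<rho> replaces such a set
    by the points lying in those components.\<close>
  define \<rho> where "\<rho> C = {x \<in> topspace X. pc x \<in> C}" for C
  have car: "carrier (\<G> Mod pc ` N) = coset ` topspace X"
    by (auto simp: FactGroup_def RCOSETS_def carrier_eq)
  have \<rho>: "\<rho> (coset g) = L g" if "g \<in> topspace X" for g
    using that by (simp add: \<rho>_def left_coset_eq_vimage)
  have "\<rho> \<in> hom (\<G> Mod pc ` N) Q"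
  proof (rule homI)
    fix A B assume "A \<in> carrier (\<G> Mod pc ` N)" "B \<in> carrier (\<G> Mod pc ` N)"
    then obtain g h where gh: "g \<in> topspace X" "h \<in> topspace X" "A = coset g" "B = coset h"
      by (auto simp: car)
    then have "A \<otimes>\<^bsub>\<G> Mod pc ` N\<^esub> B = coset (\<mu> (g, h))"
      by (simp add: FactGroup_def rcos_sum carrier_eq pc_mult)
    then show "\<rho> (A \<otimes>\<^bsub>\<G> Mod pc ` N\<^esub> B) = \<rho> A \<otimes>\<^bsub>Q\<^esub> \<rho> B"
      using gh by (simp add: \<rho> mult_in left_coset_mult)
  qed (auto simp: car \<rho> coset_group_def)
  \<comment> \<open>The image of a group under a homomorphism is a group. The next two facts
    identify its carrier and unit with those of \<open>Q\<close>.\<close>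
  then have "group (Q\<lparr>carrier := \<rho> ` carrier (\<G> Mod pc ` N), one := \<rho> \<one>\<^bsub>\<G> Mod pc ` N\<^esub>\<rparr>)"
    by (rule group.hom_imp_img_group[OF factorgroup_is_group])
  moreover have "\<rho> ` carrier (\<G> Mod pc ` N) = L ` topspace X"
    by (simp add: car image_image \<rho>)
  moreover have "\<rho> \<one>\<^bsub>\<G> Mod pc ` N\<^esub> = L p0"
    using \<rho>[OF base_in] one_eq coset_mult_one[OF subset] by (simp add: FactGroup_def)
  ultimately show ?thesis
    by (simp add: coset_group_def)
qed

lemma left_coset_inv:
  assumes "g \<in> topspace X"
  shows "inv\<^bsub>Q\<^esub> (L g) = L (\<eta> g)"
proof (rule group.inv_equality[OF group_coset_group])
  have "pc (\<mu> (\<eta> g, g)) = pc p0"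
    using assms pc_l_inv by (simp add: pc_mult inv_in one_eq)
  \<comment> \<open>\<open>coset\<close> depends on a point only through its component.\<close>
  then have "L (\<mu> (\<eta> g, g)) = L p0"
    using assms by (simp add: left_coset_eq_iff mult_in inv_in base_in)
  then show "L (\<eta> g) \<otimes>\<^bsub>Q\<^esub> L g = \<one>\<^bsub>Q\<^esub>"
    using assms by (simp add: left_coset_mult inv_in) (simp add: coset_group_def)
qed (simp_all add: coset_group_def assms inv_in)

section \<open>Continuity on the quotient\<close>

lemma continuous_map_quotient_lift:
  assumes f: "continuous_map X X f" and lift: "\<And>x. x \<in> topspace X \<Longrightarrow> F (L x) = L (f x)"
  shows "continuous_map (quotient_topology X L) (quotient_topology X L) F"
\<comment> \<open>By the universal property of the quotient, it suffices that
  \<open>F \<circ> L\<close> is continuous, and it agrees with \<open>L \<circ> f\<close> on the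
  space.\<close>
proof (rule continuous_compose_quotient_map[OF quotient_map_quotient_topology])
  have "continuous_map X (quotient_topology X L) (L \<circ> f)"
    by (rule continuous_map_compose[OF f quotient_imp_continuous_map[OF quotient_map_quotient_topology]])
  then show "continuous_map X (quotient_topology X L) (F \<circ> L)"
    by (rule continuous_map_eq) (simp add: lift)
qed

lemma quasitopological_coset_group: "quasitopological_group Q (quotient_topology X L)"
  unfolding quasitopological_group_def
proof (intro conjI ballI)
  have car: "carrier Q = L ` topspace X"
    by (simp add: coset_group_def)
  show "group Q"
    by (rule group_coset_group)
  show "topspace (quotient_topology X L) = carrier Q"
    by (simp add: topspace_quotient_topology car)
  show "continuous_map (quotient_topology X L) (quotient_topology X L) (\<lambda>x. inv\<^bsub>Q\<^esub> x)"
    by (rule continuous_map_quotient_lift[OF continuous_inv left_coset_inv])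
  fix a assume "a \<in> carrier Q"
  then obtain g where g: "g \<in> topspace X" "a = L g"
    by (auto simp: car)
  \<comment> \<open>Left translation by the representative \<open>g\<close> is \<mu> after the
    insertion of \<open>g\<close> as first factor; by \<open>left_coset_mult\<close> it induces
    translation by \<open>a\<close>.\<close>
  have "continuous_map X X (\<mu> \<circ> (\<lambda>x. (g, x)))"
    by (rule continuous_map_compose[OF _ continuous_mult])
      (simp add: continuous_map_pairwise o_def g)
  then show "continuous_map (quotient_topology X L) (quotient_topology X L) (\<lambda>x. a \<otimes>\<^bsub>Q\<^esub> x)"
    by (rule continuous_map_quotient_lift) (simp add: g left_coset_mult)
  have "continuous_map X X (\<mu> \<circ> (\<lambda>x. (x, g)))"
    by (rule continuous_map_compose[OF _ continuous_mult])
      (simp add: continuous_map_pairwise o_def g)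
  then show "continuous_map (quotient_topology X L) (quotient_topology X L) (\<lambda>x. x \<otimes>\<^bsub>Q\<^esub> a)"
    by (rule continuous_map_quotient_lift) (simp add: g left_coset_mult)
qed

end

end

theorem theorem5p8:
  fixes P :: "'a topology" and p0 :: 'a
    and \<mu> :: "'a \<times> 'a \<Rightarrow> 'a" and \<eta> :: "'a \<Rightarrow> 'a" and N :: "'a set"
  assumes "H_group P p0 \<mu> \<eta>"
    and "normal_sub_H_group P p0 \<mu> \<eta> N"
  shows "quasitopological_group (coset_group P p0 \<mu> \<eta> N)
           (quotient_topology P (left_coset P \<mu> \<eta> N))"
  using assms
  by (intro H_group_space.quasitopological_coset_group) (auto intro: H_group_space.intro)

end
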